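(* $d_{\mathrm{GH}}\big(\mathbb{S}^1_{\mathrm{E}},\mathbf{H}_{\geq 0}(\mathbb{S}^2_{\mathrm{E}})\big)<\frac{\sqrt{3}}{2}$.
   Context: $\mathbb{S}^n_{\mathrm{E}}$ denotes the unit sphere $\{x\in\mathbb{R}^{n+1}:\|x\|=1\}$ with the Euclidean metric $d_{\mathrm{E}}(x,x')=\|x-x'\|$ inherited from $\mathbb{R}^{n+1}$, and $\mathbf{H}_{\geq 0}(\mathbb{S}^2_{\mathrm{E}})=\{(x_1,x_2,x_3)\in\mathbb{S}^2:x_3\geq0\}$ is the closed upper hemisphere with the same Euclidean metric. The Gromov-Hausdorff distance between bounded metric spaces $X,Y$ is $d_{\mathrm{GH}}(X,Y)=\inf d_{\mathrm{H}}(f(X),g(Y))$, the infimum being over all metric spaces $Z$ and all isometric (distance-preserving) embeddings $f:X\to Z$, $g:Y\to Z$, with $d_{\mathrm{H}}$ the Hausdorff distance in $Z$. Equivalently $d_{\mathrm{GH}}(X,Y)=\frac12\inf_R \operatorname{dis}(R)$, where $R\subseteq X\times Y$ ranges over correspondences (relations whose projections to $X$ and to $Y$ are both surjective) and $\operatorname{dis}(R)=\sup_{(x,y),(x',y')\in R}|d_X(x,x')-d_Y(y,y')|$. *)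

theory Defs
  imports "HOL-Analysis.Analysis"
begin

text \<open>
  Hausdorff and Gromov-Hausdorff distances take values in the type \<open>ennreal\<close>, so that every
  supremum and infimum is an honest one (over the reals, \<open>Inf {}\<close> and suprema of unbounded
  sets are unspecified). On nonempty bounded spaces both are finite and are the usual real
  numbers.
\<close>

definition hausdorff_dist :: "'a metric \<Rightarrow> 'a set \<Rightarrow> 'a set \<Rightarrow> ennreal" where
  "hausdorff_dist Z A B =
     max (SUP a\<in>A. INF b\<in>B. ennreal (mdist Z a b)) (SUP b\<in>B. INF a\<in>A. ennreal (mdist Z a b))"

definition isometric_embedding :: "'a metric \<Rightarrow> 'b metric \<Rightarrow> ('a \<Rightarrow> 'b) \<Rightarrow> bool" where
  "isometric_embedding X Z f \<longleftrightarrow>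
     f \<in> mspace X \<rightarrow> mspace Z \<and>
     (\<forall>x\<in>mspace X. \<forall>x'\<in>mspace X. mdist Z (f x) (f x') = mdist X x x')"

text \<open>
  A term cannot quantify over the carrier type of the ambient space \<open>Z\<close>. It suffices to let
  \<open>Z\<close> range over all metric spaces whose points lie in the sum type: only the subspace
  \<open>f ` X \<union> g ` Y\<close> matters, and it can be relabelled by elements of \<open>'a + 'b\<close>. The lemma
  \<open>gromov_hausdorff_dist_le\<close> below makes this precise: the infimum is a lower bound for
  metric spaces \<open>Z\<close> over any type.
\<close>

definition gromov_hausdorff_dist :: "'a metric \<Rightarrow> 'b metric \<Rightarrow> ennreal" where
  "gromov_hausdorff_dist X Y =
     Inf {hausdorff_dist Z (f ` mspace X) (g ` mspace Y) | (Z :: ('a + 'b) metric) f g.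
            isometric_embedding X Z f \<and> isometric_embedding Y Z g}"

lemma isometric_embedding_inj_on:
  assumes "isometric_embedding X Z f"
  shows "inj_on f (mspace X)"
proof (rule inj_onI)
  fix x y assume xy: "x \<in> mspace X" "y \<in> mspace X" and eq: "f x = f y"
  have fx: "f x \<in> mspace Z"
    using assms xy unfolding isometric_embedding_def by blast
  have "mdist X x y = mdist Z (f x) (f y)"
    using assms xy unfolding isometric_embedding_def by simp
  also have "\<dots> = 0"
    using fx eq by simp
  finally show "x = y"
    using xy by simp
qed

lemma gromov_hausdorff_dist_le:
  fixes X :: "'a metric" and Y :: "'b metric" and Z :: "'c metric"
  assumes f: "isometric_embedding X Z f" and g: "isometric_embedding Y Z g"
  shows "gromov_hausdorff_dist X Y \<le> hausdorff_dist Z (f ` mspace X) (g ` mspace Y)"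
proof -
  define U where "U = f ` mspace X \<union> g ` mspace Y"
  define h :: "'c \<Rightarrow> 'a + 'b" where
    "h = (\<lambda>z. if z \<in> f ` mspace X then Inl (inv_into (mspace X) f z)
              else Inr (inv_into (mspace Y) g z))"
  define k where "k = inv_into U h"
  define d where "d = (\<lambda>p q. mdist Z (k p) (k q))"
  have UZ: "U \<subseteq> mspace Z"
    using f g unfolding U_def isometric_embedding_def by blast
  have inj: "inj_on h U"
  proof (rule inj_onI)
    fix z w assume "z \<in> U" "w \<in> U" "h z = h w"
    then show "z = w"
      unfolding U_def h_def by (auto split: if_splits dest: inv_into_injective)
  qed
  have kh: "k (h z) = z" if "z \<in> U" for z
    using inj that unfolding k_def by simp
  have "Metric_space (h ` U) d"
  proof
    fix p q r
    show "0 \<le> d p q" and "d p q = d q p"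
      by (simp_all add: d_def mdist_commute)
    show "d p q = 0 \<longleftrightarrow> p = q" if "p \<in> h ` U" "q \<in> h ` U"
      using that UZ kh unfolding d_def by (auto simp: subset_iff)
    show "d p r \<le> d p q + d q r" if "p \<in> h ` U" "q \<in> h ` U" "r \<in> h ` U"
      using that UZ kh unfolding d_def by (auto intro!: mdist_triangle)
  qed
  define W where "W = metric (h ` U, d)"
  have W: "mspace W = h ` U" "mdist W = d"
    using \<open>Metric_space (h ` U) d\<close>
    by (simp_all add: W_def Metric_space.mspace_metric Metric_space.mdist_metric)
  have fU: "f x \<in> U" if "x \<in> mspace X" for x
    using that by (simp add: U_def)
  have gU: "g y \<in> U" if "y \<in> mspace Y" for y
    using that by (simp add: U_def)
  have "isometric_embedding X W (h \<circ> f)" "isometric_embedding Y W (h \<circ> g)"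
    using f g fU gU by (auto simp: isometric_embedding_def W d_def kh)
  moreover have "hausdorff_dist W ((h \<circ> f) ` mspace X) ((h \<circ> g) ` mspace Y) =
      hausdorff_dist Z (f ` mspace X) (g ` mspace Y)"
    unfolding hausdorff_dist_def image_image
    by (simp add: W d_def kh fU gU cong: SUP_cong_simp INF_cong_simp)
  ultimately show ?thesis
    unfolding gromov_hausdorff_dist_def by (intro Inf_lower) force
qed

definition sphere1_E :: "(real ^ 2) metric" where
  "sphere1_E = submetric euclidean_metric (sphere 0 1)"

definition hemisphere2_E :: "(real ^ 3) metric" where
  "hemisphere2_E = submetric euclidean_metric {x \<in> sphere 0 1. x $ 3 \<ge> 0}"

end

theory Submission
  imports Defs
begin

text \<open>
  A correspondence of distortion at most \<open>2 * r\<close> between two metric spaces bounds their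
  Gromov-Hausdorff distance by \<open>r\<close> (lemma \<open>gromov_hausdorff_dist_le_correspondence\<close>), so it is
  enough to find a correspondence between the circle and the hemisphere whose distortion is at
  most \<open>17/10 < sqrt 3\<close>.

  All distances in question are at most \<open>2\<close>. Hence two pairs \<open>(u, x)\<close> and \<open>(v, y)\<close> can violate
  this bound only when one of the two distances is below \<open>3/10\<close> and the other one above
  \<open>17/10\<close>. In terms of inner products, \<open>dist u v \<ge> 3/10\<close> means \<open>u \<bullet> v \<le> 191/200\<close> and
  \<open>dist u v \<le> 17/10\<close> means \<open>u \<bullet> v \<ge> - 89/200\<close>; this is the predicate \<open>compatible\<close>. So any two
  pieces of the hemisphere that come close to each other must go to points less than about 116
  degrees apart, and pieces containing nearly antipodal points must go to points more than about
  17 degrees apart; apart from that the correspondence may be discontinuous.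

  The correspondence is a union of eight products, each with a piece of the hemisphere on one side
  and a piece of the circle on the other, one of the two being a single point. They come in
  pairs, indexed by a sign \<open>\<sigma>\<close>. Think of the hemisphere as cut by the
  coordinate \<open>x$1\<close>: the two sides \<open>\<sigma> * x$1 \<ge> 11/20\<close> go to the points at \<open>\<sigma> * 90\<close> degrees, and
  the strip between them, halved by the sign of \<open>x$2\<close>, goes to two points at about \<open>\<sigma> * 16\<close>
  degrees. Cutting the strip in two keeps its antipodal points from sharing their image. Each of
  the four pieces then has a diameter below 116 degrees, and the two sides, which are the only pieces sent far
  apart, do not come close to each other.
  This takes care of every point of the hemisphere, but it uses only four points of the circle.
  To reach all the others, each quadrant of the circle is attached to one single point of the
  hemisphere: the two quadrants of the right half circle to two points near the pole, which are
  well away from both sides, and the two quadrants of the left half circle to one point inside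
  each side, well away from the strip. These single points are placed so that around each of them
  the rest of the correspondence takes only values close to its whole quadrant; near the point
  inside the side of sign \<open>\<sigma>\<close>, for instance, the only value is the end point of its quadrant at
  \<open>\<sigma> * 90\<close> degrees.
  Finally, neighbouring quadrants share an end point, so the four special points must also be
  less than about 116 degrees apart from each other.
\<close>

section \<open>Correspondences bound the Gromov-Hausdorff distance\<close>

text \<open>
  The two spaces are glued along the correspondence: a pair of related points is joined by a bridge
  of length \<open>r\<close>, and the distance of \<open>x\<close> and \<open>y\<close> is the infimum of the lengths of paths
  over one bridge.
  A path that leaves a space and returns to it crosses two bridges, and their total length
  \<open>2 * r\<close> pays for the distortion. So such a path is never a shortcut, and both embeddings are
  isometric.
\<close>

lemma gromov_hausdorff_dist_le_correspondence:
  fixes X :: "'a metric" and Y :: "'b metric" and R :: "('a \<times> 'b) set" and r :: real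
  assumes dom: "Domain R = mspace X" and ran: "Range R = mspace Y" and r: "r > 0"
    and dis: "\<And>x y x' y'. (x, y) \<in> R \<Longrightarrow> (x', y') \<in> R \<Longrightarrow>
                \<bar>mdist X x x' - mdist Y y y'\<bar> \<le> 2 * r"
  shows "gromov_hausdorff_dist X Y \<le> ennreal r"
proof -
  define c where "c x y = (INF p\<in>R. mdist X x (fst p) + r + mdist Y (snd p) y)" for x y
  have c_le: "c x y \<le> mdist X x a + r + mdist Y b y" if "(a, b) \<in> R" for x y a b
  proof -
    have "bdd_below ((\<lambda>p. mdist X x (fst p) + r + mdist Y (snd p) y) ` R)"
      using r by (intro bdd_belowI[of _ 0]) (auto intro!: add_nonneg_nonneg)
    from cINF_lower[OF this that] show ?thesis
      by (simp add: c_def)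
  qed
  have c_ge: "m \<le> c x y"
    if "x \<in> mspace X" and "\<And>a b. (a, b) \<in> R \<Longrightarrow> m \<le> mdist X x a + r + mdist Y b y" for x y m
  proof -
    have "R \<noteq> {}" using that(1) dom by auto
    then show ?thesis
      unfolding c_def using that(2) by (intro cINF_greatest) auto
  qed
  have R_mem: "a \<in> mspace X" "b \<in> mspace Y" if "(a, b) \<in> R" for a b
    using that dom ran by auto
  have c_ge_r: "r \<le> c x y" if "x \<in> mspace X" for x y
    using that by (intro c_ge) (auto simp: add_increasing add_increasing2)
  \<comment> \<open>The triangle inequality for two points of one space and one point of the other: first with
    the odd point in the middle, where the distortion enters, then at an end.\<close>
  have XX: "mdist X x x' \<le> c x y + c x' y"
    if "x \<in> mspace X" "x' \<in> mspace X" "y \<in> mspace Y" for x x' y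
  proof -
    have "mdist X x x' - c x' y \<le> mdist X x a + r + mdist Y b y" if ab: "(a, b) \<in> R" for a b
    proof -
      have "mdist X x x' - (mdist X x a + r + mdist Y b y) \<le> mdist X x' a' + r + mdist Y b' y"
        if ab': "(a', b') \<in> R" for a' b'
      proof -
        note m = R_mem[OF ab] R_mem[OF ab'] \<open>x \<in> _\<close> \<open>x' \<in> _\<close> \<open>y \<in> _\<close>
        have "mdist X x x' \<le> mdist X x a + mdist X a a' + mdist X x' a'"
          using m mdist_triangle[of x X a x'] mdist_triangle[of a X a' x']
          by (simp add: mdist_commute)
        moreover have "mdist Y b b' \<le> mdist Y b y + mdist Y b' y"
          using m mdist_triangle[of b Y y b'] by (simp add: mdist_commute)
        ultimately show ?thesis
          using dis[OF ab ab'] by linarith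
      qed
      from c_ge[OF \<open>x' \<in> _\<close> this] show ?thesis by simp
    qed
    from c_ge[OF \<open>x \<in> _\<close> this] show ?thesis by simp
  qed
  have YY: "mdist Y y y' \<le> c x y + c x y'"
    if "y \<in> mspace Y" "y' \<in> mspace Y" "x \<in> mspace X" for x y y'
  proof -
    have "mdist Y y y' - c x y' \<le> mdist X x a + r + mdist Y b y" if ab: "(a, b) \<in> R" for a b
    proof -
      have "mdist Y y y' - (mdist X x a + r + mdist Y b y) \<le> mdist X x a' + r + mdist Y b' y'"
        if ab': "(a', b') \<in> R" for a' b'
      proof -
        note m = R_mem[OF ab] R_mem[OF ab'] \<open>x \<in> _\<close> \<open>y' \<in> _\<close> \<open>y \<in> _\<close>
        have "mdist Y y y' \<le> mdist Y b y + mdist Y b b' + mdist Y b' y'"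
          using m mdist_triangle[of y Y b y'] mdist_triangle[of b Y b' y']
          by (simp add: mdist_commute)
        moreover have "mdist X a a' \<le> mdist X x a + mdist X x a'"
          using m mdist_triangle[of a X x a'] by (simp add: mdist_commute)
        ultimately show ?thesis
          using dis[OF ab ab'] by linarith
      qed
      from c_ge[OF \<open>x \<in> _\<close> this] show ?thesis by simp
    qed
    from c_ge[OF \<open>x \<in> _\<close> this] show ?thesis by simp
  qed
  have XY: "c x y \<le> mdist X x x' + c x' y" if "x \<in> mspace X" "x' \<in> mspace X" for x x' y
  proof -
    have "c x y - mdist X x x' \<le> mdist X x' a + r + mdist Y b y" if ab: "(a, b) \<in> R" for a b
      using c_le[OF ab, of x y] mdist_triangle[of x X x' a] R_mem[OF ab] \<open>x \<in> _\<close> \<open>x' \<in> _\<close> by simp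
    from c_ge[OF \<open>x' \<in> _\<close> this] show ?thesis by simp
  qed
  have YX: "c x y \<le> c x y' + mdist Y y' y"
    if "x \<in> mspace X" "y \<in> mspace Y" "y' \<in> mspace Y" for x y y'
  proof -
    have "c x y - mdist Y y' y \<le> mdist X x a + r + mdist Y b y'" if ab: "(a, b) \<in> R" for a b
      using c_le[OF ab, of x y] mdist_triangle[of b Y y' y] R_mem[OF ab] \<open>y \<in> _\<close> \<open>y' \<in> _\<close> by simp
    from c_ge[OF \<open>x \<in> _\<close> this] show ?thesis by simp
  qed
  define d where "d p q = (case (p, q) of
      (Inl x, Inl x') \<Rightarrow> mdist X x x' | (Inr y, Inr y') \<Rightarrow> mdist Y y y'
    | (Inl x, Inr y) \<Rightarrow> c x y | (Inr y, Inl x) \<Rightarrow> c x y)" for p q :: "'a + 'b"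
  have d_simps: "d (Inl x) (Inl x') = mdist X x x'" "d (Inr y) (Inr y') = mdist Y y y'"
      "d (Inl x) (Inr y) = c x y" "d (Inr y) (Inl x) = c x y" for x x' y y'
    by (simp_all add: d_def)
  define U where "U = Inl ` mspace X \<union> Inr ` mspace Y"
  have pos: "0 < c x y" if "x \<in> mspace X" for x y
    using c_ge_r[OF that, of y] r by linarith
  \<comment> \<open>Nonnegativity and symmetry are required off the carrier as well, hence the default value.\<close>
  have "Metric_space U (\<lambda>p q. if p \<in> U \<and> q \<in> U then d p q else 0)"
  proof
    fix p q s
    show "0 \<le> (if p \<in> U \<and> q \<in> U then d p q else 0)"
      using pos by (auto simp: U_def d_simps less_imp_le)
    show "(if p \<in> U \<and> q \<in> U then d p q else 0) = (if q \<in> U \<and> p \<in> U then d q p else 0)"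
      by (cases p; cases q) (auto simp: d_simps mdist_commute)
    show "(if p \<in> U \<and> q \<in> U then d p q else 0) = 0 \<longleftrightarrow> p = q" if "p \<in> U" "q \<in> U"
      using that pos by (auto simp: U_def d_simps) (metis less_irrefl)+
    show "(if p \<in> U \<and> s \<in> U then d p s else 0)
        \<le> (if p \<in> U \<and> q \<in> U then d p q else 0) + (if q \<in> U \<and> s \<in> U then d q s else 0)"
      if "p \<in> U" "q \<in> U" "s \<in> U"
      using that XX YY XY YX
      by (auto simp: U_def d_simps mdist_triangle) (metis add.commute mdist_commute)+
  qed
  define Z where "Z = metric (U, \<lambda>p q. if p \<in> U \<and> q \<in> U then d p q else 0)"
  have Z: "mspace Z = U" "mdist Z = (\<lambda>p q. if p \<in> U \<and> q \<in> U then d p q else 0)"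
    using \<open>Metric_space U _\<close>
    by (simp_all add: Z_def Metric_space.mspace_metric Metric_space.mdist_metric)
  have "isometric_embedding X Z Inl" "isometric_embedding Y Z Inr"
    by (auto simp: isometric_embedding_def Z U_def d_simps)
  then have "gromov_hausdorff_dist X Y \<le> hausdorff_dist Z (Inl ` mspace X) (Inr ` mspace Y)"
    by (rule gromov_hausdorff_dist_le)
  also have "\<dots> \<le> ennreal r"
  proof -
    have near: "mdist Z (Inl x) (Inr y) \<le> r" if "(x, y) \<in> R" for x y
    proof -
      have self: "mdist X x x = 0" "mdist Y y y = 0" using R_mem[OF that] by simp_all
      then show ?thesis
        using c_le[OF that, of x y] R_mem[OF that] by (simp add: Z U_def d_simps self)
    qed
    have "(INF q\<in>Inr ` mspace Y. ennreal (mdist Z (Inl x) q)) \<le> ennreal r"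
      if x: "x \<in> mspace X" for x
    proof -
      obtain y where y: "(x, y) \<in> R" using x dom by auto
      show ?thesis
        by (rule INF_lower2[of "Inr y"]) (use R_mem[OF y] near[OF y] in \<open>auto intro: ennreal_leI\<close>)
    qed
    moreover have "(INF p\<in>Inl ` mspace X. ennreal (mdist Z p (Inr y))) \<le> ennreal r"
      if y: "y \<in> mspace Y" for y
    proof -
      obtain x where x: "(x, y) \<in> R" using y ran by auto
      show ?thesis
        by (rule INF_lower2[of "Inl x"]) (use R_mem[OF x] near[OF x] in \<open>auto intro: ennreal_leI\<close>)
    qed
    ultimately show ?thesis
      by (auto simp: hausdorff_dist_def intro!: SUP_least)
  qed
  finally show ?thesis .
qed

section \<open>Distortion and inner products of unit vectors\<close>

text \<open>
  The distance of unit vectors with inner product \<open>a\<close> is \<open>sqrt (2 - 2 * a)\<close>: it equals \<open>3/10\<close>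
  for \<open>a = 191/200\<close> and \<open>17/10\<close> for \<open>a = - 89/200\<close>.
\<close>

definition compatible :: "real \<Rightarrow> real \<Rightarrow> bool" where
  "compatible a b \<longleftrightarrow> (a \<le> 191/200 \<or> - 89/200 \<le> b) \<and> (b \<le> 191/200 \<or> - 89/200 \<le> a)"

lemma dist_unit_vectors:
  fixes x y :: "'a :: real_inner"
  assumes "norm x = 1" "norm y = 1"
  shows "(dist x y)\<^sup>2 = 2 - 2 * (x \<bullet> y)"
  using assms unfolding dist_norm power2_norm_eq_inner
  by (simp add: inner_diff inner_commute norm_eq_1)

text \<open>
  Since \<open>17/10 + 3/10 = 2\<close> is the diameter of a sphere, one distance exceeds another by at most
  \<open>17/10\<close> as soon as the larger one is at most \<open>17/10\<close> or the smaller one is at least \<open>3/10\<close>.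
\<close>

lemma compatible_imp_distortion_le:
  fixes u u' :: "'a :: real_inner" and x x' :: "'b :: real_inner"
  assumes "norm u = 1" "norm u' = 1" "norm x = 1" "norm x' = 1"
    and "compatible (u \<bullet> u') (x \<bullet> x')"
  shows "\<bar>dist u u' - dist x x'\<bar> \<le> 17/10"
proof -
  have upper: "s \<le> 17/10 + t"
    if s: "s\<^sup>2 = 2 - 2 * a" "\<bar>a\<bar> \<le> 1" "0 \<le> s" and t: "t\<^sup>2 = 2 - 2 * b" "0 \<le> t"
      and ab: "b \<le> 191/200 \<or> - 89/200 \<le> a" for s t a b :: real
    using ab
  proof
    assume "b \<le> 191/200"
    then have "(3/10)\<^sup>2 \<le> t\<^sup>2" using t by (simp add: power2_eq_square)
    then have "3/10 \<le> t" using t(2) by (rule power2_le_imp_le)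
    moreover have "s\<^sup>2 \<le> 2\<^sup>2" using s by (simp add: power2_eq_square)
    then have "s \<le> 2" by (rule power2_le_imp_le) simp
    ultimately show ?thesis by linarith
  next
    assume "- 89/200 \<le> a"
    then have "s\<^sup>2 \<le> (17/10)\<^sup>2" using s by (simp add: power2_eq_square)
    then have "s \<le> 17/10" by (rule power2_le_imp_le) simp
    then show ?thesis using t by linarith
  qed
  have "\<bar>u \<bullet> u'\<bar> \<le> 1" "\<bar>x \<bullet> x'\<bar> \<le> 1"
    using assms Cauchy_Schwarz_ineq2[of u u'] Cauchy_Schwarz_ineq2[of x x'] by simp_all
  then have "dist u u' \<le> 17/10 + dist x x'" "dist x x' \<le> 17/10 + dist u u'"
    using assms(5) unfolding compatible_def
    by (auto intro!: upper[OF dist_unit_vectors[OF assms(1,2)] _ _ dist_unit_vectors[OF assms(3,4)]]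
        upper[OF dist_unit_vectors[OF assms(3,4)] _ _ dist_unit_vectors[OF assms(1,2)]])
  then show ?thesis by linarith
qed

section \<open>The correspondence\<close>

definition circle :: "(real ^ 2) set" where
  "circle = sphere 0 1"

definition hemisphere :: "(real ^ 3) set" where
  "hemisphere = {x \<in> sphere 0 1. x $ 3 \<ge> 0}"

lemma circle_iff: "u \<in> circle \<longleftrightarrow> (u$1)\<^sup>2 + (u$2)\<^sup>2 = 1"
  by (simp add: circle_def norm_eq_1 inner_vec_def sum_2 power2_eq_square)

lemma hemisphere_iff:
  "x \<in> hemisphere \<longleftrightarrow> (x$1)\<^sup>2 + (x$2)\<^sup>2 + (x$3)\<^sup>2 = 1 \<and> 0 \<le> x$3"
  by (simp add: hemisphere_def norm_eq_1 inner_vec_def sum_3 power2_eq_square)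

text \<open>
  The constants give all points rational coordinates and meet the following constraints. Each side has points \<open>2 * arccos (11/20)\<close> apart, about 113 degrees, which must stay below 116; a
  larger cut-off would give smaller sides, but it would bring the strip too close to the tips.
  The tips have inner product \<open>- 7/25\<close> with each other and at most \<open>0.942\<close> with the strip.
  The angle of the points \<open>(24/25, \<sigma> * 7/25)\<close> is about 16 degrees: their inner product \<open>527/625\<close> is
  below \<open>191/200\<close>, while each of them has inner product at least \<open>- 7/25\<close> with the points of the
  right half circle. The same angle separates the two pole points, with the same inner product.
\<close>

inductive_set circle_hemisphere_corr :: "((real ^ 2) \<times> (real ^ 3)) set" where
  side: "\<lbrakk>\<sigma> \<in> {1, -1}; x \<in> hemisphere; 11/20 \<le> \<sigma> * x$1\<rbrakk>
    \<Longrightarrow> (vector [0, \<sigma>], x) \<in> circle_hemisphere_corr"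
| strip: "\<lbrakk>\<sigma> \<in> {1, -1}; x \<in> hemisphere; \<bar>x$1\<bar> \<le> 11/20; 0 \<le> \<sigma> * x$2\<rbrakk>
    \<Longrightarrow> (vector [24/25, \<sigma> * (7/25)], x) \<in> circle_hemisphere_corr"
| pole: "\<lbrakk>\<sigma> \<in> {1, -1}; u \<in> circle; 0 \<le> u$1; 0 \<le> \<sigma> * u$2\<rbrakk>
    \<Longrightarrow> (u, vector [0, \<sigma> * (7/25), 24/25]) \<in> circle_hemisphere_corr"
| tip: "\<lbrakk>\<sigma> \<in> {1, -1}; u \<in> circle; u$1 \<le> 0; 0 \<le> \<sigma> * u$2\<rbrakk>
    \<Longrightarrow> (u, vector [\<sigma> * (4/5), 0, 3/5]) \<in> circle_hemisphere_corr"

lemma circle_hemisphere_corr_subset: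
  "(u, x) \<in> circle_hemisphere_corr \<Longrightarrow> u \<in> circle \<and> x \<in> hemisphere"
  by (erule circle_hemisphere_corr.cases) (auto simp: circle_iff hemisphere_iff power2_eq_square)

lemma Domain_circle_hemisphere_corr: "Domain circle_hemisphere_corr = circle"
proof
  show "Domain circle_hemisphere_corr \<subseteq> circle" using circle_hemisphere_corr_subset by auto
  show "circle \<subseteq> Domain circle_hemisphere_corr"
  proof
    fix u assume u: "u \<in> circle"
    obtain \<sigma> :: real where "\<sigma> \<in> {1, -1}" "0 \<le> \<sigma> * u$2"
      by (cases "0 \<le> u$2") (auto intro: that[of 1] that[of "-1"])
    with u show "u \<in> Domain circle_hemisphere_corr"
      using circle_hemisphere_corr.pole[of \<sigma> u] circle_hemisphere_corr.tip[of \<sigma> u]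
      by (cases "0 \<le> u$1") auto
  qed
qed

lemma Range_circle_hemisphere_corr: "Range circle_hemisphere_corr = hemisphere"
proof
  show "Range circle_hemisphere_corr \<subseteq> hemisphere" using circle_hemisphere_corr_subset by auto
  show "hemisphere \<subseteq> Range circle_hemisphere_corr"
  proof
    fix x assume x: "x \<in> hemisphere"
    consider "\<bar>x$1\<bar> \<le> 11/20" "0 \<le> 1 * x$2" | "\<bar>x$1\<bar> \<le> 11/20" "0 \<le> (-1) * x$2"
      | "11/20 \<le> 1 * x$1" | "11/20 \<le> (-1) * x$1"
      by linarith
    then show "x \<in> Range circle_hemisphere_corr"
      by cases (use x circle_hemisphere_corr.strip[of _ x] circle_hemisphere_corr.side[of _ x]
        in \<open>blast intro: RangeI\<close>)+
  qed
qed

section \<open>Compatibility of any two cells\<close>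

lemma inner_2: "u \<bullet> v = u$1 * v$1 + u$2 * v$2" for u v :: "real ^ 2"
  by (simp add: inner_vec_def sum_2)

lemma inner_3: "x \<bullet> y = x$1 * y$1 + x$2 * y$2 + x$3 * y$3" for x y :: "real ^ 3"
  by (simp add: inner_vec_def sum_3)

lemma hemisphere_coord_le_1:
  assumes "x \<in> hemisphere"
  shows "\<bar>x$2\<bar> \<le> 1" "0 \<le> x$3" "x$3 \<le> 1"
  using assms component_le_norm_cart[of x 2] component_le_norm_cart[of x 3]
  by (auto simp: hemisphere_def)

lemma circle_coord_le_1:
  assumes "u \<in> circle"
  shows "\<bar>u$1\<bar> \<le> 1" "\<bar>u$2\<bar> \<le> 1"
  using assms component_le_norm_cart[of u 1] component_le_norm_cart[of u 2]
  by (auto simp: circle_def)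

lemma inner_same_quadrant:
  fixes u v :: "real ^ 2"
  assumes "\<sigma> \<in> {1, -1}" "0 \<le> u$1 * v$1" "0 \<le> \<sigma> * u$2" "0 \<le> \<sigma> * v$2"
  shows "0 \<le> u \<bullet> v"
proof -
  have "0 \<le> u$2 * v$2" using assms by (auto intro: mult_nonneg_nonneg mult_nonpos_nonpos)
  then show ?thesis using assms by (simp add: inner_2)
qed

text \<open>
  Within the hemisphere the third coordinates cannot drive two points apart, so a lower bound for
  the inner product needs only the other two.
\<close>

lemma hemisphere_inner_ge:
  assumes x: "x \<in> hemisphere" and y: "y \<in> hemisphere"
  shows "x$1 * y$1 + x$2 * y$2 \<le> x \<bullet> y"
  using assms by (simp add: inner_3 hemisphere_iff)

text \<open>
  On a side, \<open>x$2\<close> and \<open>x$3\<close> contribute at most \<open>1 - (11/20)\<^sup>2 = 279/400\<close> to the squared norm. Thus the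
  first coordinates, whose product is at least \<open>121/400\<close> in absolute value, decide: points of the
  same side are not too far apart, and points of opposite sides are not too close.
\<close>

lemma compatible_side_side:
  assumes st: "\<sigma> \<in> {1, -1}" "\<tau> \<in> {1, -1}" and xy: "x \<in> hemisphere" "y \<in> hemisphere"
    and s: "11/20 \<le> \<sigma> * x$1" "11/20 \<le> \<tau> * y$1"
  shows "compatible ((vector [0, \<sigma>] :: real^2) \<bullet> vector [0, \<tau>]) (x \<bullet> y)"
proof -
  have "(11/20) * (11/20) \<le> (\<sigma> * x$1) * (\<tau> * y$1)"
    using s by (intro mult_mono) auto
  then have p: "121/400 \<le> (\<sigma> * x$1) * (\<tau> * y$1)" by simp
  have "(11/20)\<^sup>2 \<le> (x$1)\<^sup>2" "(11/20)\<^sup>2 \<le> (y$1)\<^sup>2"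
    using st s by (auto simp flip: abs_le_square_iff)
  then have sq: "(x$2)\<^sup>2 + (x$3)\<^sup>2 \<le> 279/400" "(y$2)\<^sup>2 + (y$3)\<^sup>2 \<le> 279/400"
    using xy by (simp_all add: hemisphere_iff power2_eq_square[of "11/20"])
  show ?thesis
  proof (cases "\<sigma> = \<tau>")
    case True
    then have "121/400 \<le> x$1 * y$1" using p st by auto
    moreover have "- (279/400) \<le> x$2 * y$2"
    proof -
      have "0 \<le> (x$2)\<^sup>2 + 2 * (x$2 * y$2) + (y$2)\<^sup>2"
        using zero_le_power2[of "x$2 + y$2"] by (simp add: power2_sum algebra_simps)
      then show ?thesis
        using sq zero_le_power2[of "x$3"] zero_le_power2[of "y$3"] by linarith
    qed
    ultimately have "- 89/200 \<le> x \<bullet> y"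
      using hemisphere_inner_ge[OF xy] by linarith
    then show ?thesis using True st by (auto simp: compatible_def inner_2)
  next
    case False
    then have "x$1 * y$1 \<le> - (121/400)" using p st by auto
    moreover have "x$2 * y$2 + x$3 * y$3 \<le> 279/400"
      using sq sum_squares_bound[of "x$2" "y$2"] sum_squares_bound[of "x$3" "y$3"] by linarith
    ultimately have "x \<bullet> y \<le> 191/200"
      unfolding inner_3 by linarith
    then show ?thesis using False st by (auto simp: compatible_def inner_2)
  qed
qed

lemma compatible_side_strip:
  assumes "\<sigma> \<in> {1, -1}" "\<tau> \<in> {1, -1}"
  shows "compatible ((vector [0, \<sigma>] :: real^2) \<bullet> vector [24/25, \<tau> * (7/25)]) a"
  using assms by (auto simp: compatible_def inner_2)

text \<open>
  The pole points are close enough to the north pole to be less than 116 degrees away from every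
  point of the hemisphere, so the only danger is a nearby point with a value
  far from their quadrant.
\<close>

lemma pole_inner_ge:
  assumes "\<tau> \<in> {1, -1}" "x \<in> hemisphere"
  shows "- 7/25 \<le> x \<bullet> vector [0, \<tau> * (7/25), 24/25]"
  using assms hemisphere_coord_le_1[OF assms(2)] by (auto simp: inner_3)

text \<open>
  Opposite signs are the delicate case: the quadrant of the pole point then contains the antipode
  of the point assigned to the side. It is harmless because both pole points have first
  coordinate \<open>0\<close> and are therefore far from either side.
\<close>

lemma compatible_side_pole:
  assumes st: "\<sigma> \<in> {1, -1}" "\<tau> \<in> {1, -1}" and x: "x \<in> hemisphere" "11/20 \<le> \<sigma> * x$1"
    and u: "0 \<le> \<tau> * u$2"
  shows "compatible ((vector [0, \<sigma>] :: real^2) \<bullet> u) (x \<bullet> vector [0, \<tau> * (7/25), 24/25])"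
proof (cases "\<sigma> = \<tau>")
  case True
  then show ?thesis
    using pole_inner_ge[OF st(2) x(1)] u st by (auto simp: compatible_def inner_2)
next
  case False
  have "(11/20)\<^sup>2 \<le> (x$1)\<^sup>2"
    using st x by (auto simp flip: abs_le_square_iff)
  (* Twice the inner product is at most (x$2)^2 + (x$3)^2 + 1, hence at most 279/400 + 1. *)
  moreover have "0 \<le> (x$2 - \<tau> * (7/25))\<^sup>2" "0 \<le> (x$3 - 24/25)\<^sup>2" by simp_all
  ultimately have "x \<bullet> vector [0, \<tau> * (7/25), 24/25] \<le> 191/200"
    using st x by (auto simp: inner_3 power2_diff power2_sum hemisphere_iff power2_eq_square[of "11/20"]
       power2_eq_square[of "7/25"] power2_eq_square[of "24/25"])
  then show ?thesis using False u st by (auto simp: compatible_def inner_2)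
qed

lemma compatible_side_tip:
  assumes st: "\<sigma> \<in> {1, -1}" "\<tau> \<in> {1, -1}" and x: "x \<in> hemisphere" "11/20 \<le> \<sigma> * x$1"
    and u: "0 \<le> \<tau> * u$2"
  shows "compatible ((vector [0, \<sigma>] :: real^2) \<bullet> u) (x \<bullet> vector [\<tau> * (4/5), 0, 3/5])"
  using assms hemisphere_coord_le_1[OF x(1)] by (auto simp: compatible_def inner_2 inner_3)

text \<open>
  The two halves of the strip are assigned points that are neither close nor far. Within one half
  the second coordinates agree in sign, so only the first ones, which are small, can make the inner
  product negative.
\<close>

lemma compatible_strip_strip:
  assumes st: "\<sigma> \<in> {1, -1}" "\<tau> \<in> {1, -1}" and xy: "x \<in> hemisphere" "y \<in> hemisphere"
    and x: "\<bar>x$1\<bar> \<le> 11/20" "0 \<le> \<sigma> * x$2" and y: "\<bar>y$1\<bar> \<le> 11/20" "0 \<le> \<tau> * y$2"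
  shows "compatible ((vector [24/25, \<sigma> * (7/25)] :: real^2) \<bullet> vector [24/25, \<tau> * (7/25)]) (x \<bullet> y)"
proof (cases "\<sigma> = \<tau>")
  case True
  have "\<bar>x$1 * y$1\<bar> \<le> (11/20) * (11/20)"
    unfolding abs_mult using x y by (intro mult_mono) auto
  moreover have "0 \<le> x$2 * y$2"
    using True x y st by (auto intro: mult_nonpos_nonpos)
  ultimately have "- 89/200 \<le> x \<bullet> y"
    using hemisphere_inner_ge[OF xy] by linarith
  then show ?thesis using True st by (auto simp: compatible_def inner_2)
next
  case False
  then show ?thesis using st by (auto simp: compatible_def inner_2)
qed

lemma compatible_strip_pole:
  assumes st: "\<sigma> \<in> {1, -1}" "\<tau> \<in> {1, -1}" and x: "x \<in> hemisphere"
    and u: "u \<in> circle" "0 \<le> u$1"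
  shows "compatible ((vector [24/25, \<sigma> * (7/25)] :: real^2) \<bullet> u)
           (x \<bullet> vector [0, \<tau> * (7/25), 24/25])"
  using pole_inner_ge[OF st(2) x] circle_coord_le_1[OF u(1)] u st
  by (auto simp: compatible_def inner_2)

text \<open>
  Neither distance is small here: a tip is about 20 degrees away from the boundary of the strip,
  and the points assigned to the strip lie in the right half plane, the quadrants assigned to the
  tips in the left one.
\<close>

lemma compatible_strip_tip:
  assumes st: "\<sigma> \<in> {1, -1}" "\<tau> \<in> {1, -1}" and x: "x \<in> hemisphere" "\<bar>x$1\<bar> \<le> 11/20"
    and u: "u \<in> circle" "u$1 \<le> 0"
  shows "compatible ((vector [24/25, \<sigma> * (7/25)] :: real^2) \<bullet> u)
           (x \<bullet> vector [\<tau> * (4/5), 0, 3/5])"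
proof -
  (* The linear function (4/5) * \<tau> * x$1 + (3/5) * x$3 is largest on the boundary of the strip, at
     \<tau> * x$1 = 11/20 and x$3 = sqrt 279 / 20, which is nearly 5/6. Both squares (nearly) vanish there,
     so they bound the quadratic constraint sharply enough by a linear one. *)
  have "0 \<le> (\<tau> * x$1 - 11/20)\<^sup>2" "0 \<le> (x$3 - 5/6)\<^sup>2" by simp_all
  moreover have "(x$1)\<^sup>2 + (x$3)\<^sup>2 \<le> 1"
    using x zero_le_power2[of "x$2"] unfolding hemisphere_iff by linarith
  ultimately have "x \<bullet> vector [\<tau> * (4/5), 0, 3/5] \<le> 191/200"
    using st x by (auto simp: inner_3 power2_eq_square algebra_simps)
  moreover have "(vector [24/25, \<sigma> * (7/25)] :: real^2) \<bullet> u \<le> 191/200"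
    using st u circle_coord_le_1[OF u(1)] by (auto simp: inner_2)
  ultimately show ?thesis by (simp add: compatible_def)
qed

lemma compatible_pole_pole:
  fixes u v :: "real ^ 2"
  assumes st: "\<sigma> \<in> {1, -1}" "\<tau> \<in> {1, -1}"
    and u: "0 \<le> u$1" "0 \<le> \<sigma> * u$2" and v: "0 \<le> v$1" "0 \<le> \<tau> * v$2"
  shows "compatible (u \<bullet> v)
           ((vector [0, \<sigma> * (7/25), 24/25] :: real^3) \<bullet> vector [0, \<tau> * (7/25), 24/25])"
proof (cases "\<sigma> = \<tau>")
  case True
  with inner_same_quadrant[of \<sigma> u v] st u v show ?thesis
    by (auto simp: compatible_def inner_3)
next
  case False
  with st show ?thesis by (auto simp: compatible_def inner_3)
qed

lemma compatible_pole_tip: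
  "compatible b ((vector [0, \<sigma> * (7/25), 24/25] :: real^3) \<bullet> vector [\<tau> * (4/5), 0, 3/5])"
  by (simp add: compatible_def inner_3)

text \<open>
  The quadrants of the two tips meet in \<open>(-1, 0)\<close>, so the tips must be less than 116 degrees
  apart. This is why they are lifted to height \<open>3/5\<close> instead of lying on the equator.
\<close>

lemma compatible_tip_tip:
  fixes u v :: "real ^ 2"
  assumes st: "\<sigma> \<in> {1, -1}" "\<tau> \<in> {1, -1}"
    and u: "u$1 \<le> 0" "0 \<le> \<sigma> * u$2" and v: "v$1 \<le> 0" "0 \<le> \<tau> * v$2"
  shows "compatible (u \<bullet> v)
           ((vector [\<sigma> * (4/5), 0, 3/5] :: real^3) \<bullet> vector [\<tau> * (4/5), 0, 3/5])"
proof (cases "\<sigma> = \<tau>")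
  case True
  with inner_same_quadrant[of \<sigma> u v] st u v show ?thesis
    by (auto simp: compatible_def inner_3 mult_nonpos_nonpos)
next
  case False
  with st show ?thesis by (auto simp: compatible_def inner_3)
qed

lemma compatible_commute:
  "compatible (u \<bullet> v) (x \<bullet> y) \<Longrightarrow> compatible (v \<bullet> u) (y \<bullet> x)"
  by (simp only: inner_commute)

lemma compatible_correspondence:
  assumes "(u, x) \<in> circle_hemisphere_corr" "(v, y) \<in> circle_hemisphere_corr"
  shows "compatible (u \<bullet> v) (x \<bullet> y)"
  using assms(1)
proof cases
  case 1: (side \<sigma>)
  from assms(2) show ?thesis
    by cases (use 1 in \<open>blast intro: compatible_side_side
      compatible_side_strip
      compatible_side_pole
      compatible_side_tip\<close>)+
next
  case 1: (strip \<sigma>)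
  from assms(2) show ?thesis
    by cases (use 1 in \<open>blast intro: compatible_strip_strip
      compatible_strip_pole
      compatible_strip_tip
      compatible_side_strip[THEN compatible_commute]\<close>)+
next
  case 1: (pole \<sigma>)
  from assms(2) show ?thesis
    by cases (use 1 in \<open>blast intro: compatible_pole_pole
      compatible_pole_tip
      compatible_side_pole[THEN compatible_commute]
      compatible_strip_pole[THEN compatible_commute]\<close>)+
next
  case 1: (tip \<sigma>)
  from assms(2) show ?thesis
    by cases (use 1 in \<open>blast intro: compatible_tip_tip
      compatible_side_tip[THEN compatible_commute]
      compatible_strip_tip[THEN compatible_commute]
      compatible_pole_tip[THEN compatible_commute]\<close>)+
qed

section \<open>The Gromov-Hausdorff distance of circle and hemisphere\<close>

theorem proposition9p10:
  shows "gromov_hausdorff_dist sphere1_E hemisphere2_E < ennreal (sqrt 3 / 2)"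
proof -
  have "gromov_hausdorff_dist sphere1_E hemisphere2_E \<le> ennreal (17/20)"
  proof (rule gromov_hausdorff_dist_le_correspondence)
    show "Domain circle_hemisphere_corr = mspace sphere1_E"
      by (simp add: Domain_circle_hemisphere_corr sphere1_E_def circle_def)
    show "Range circle_hemisphere_corr = mspace hemisphere2_E"
      by (simp add: Range_circle_hemisphere_corr hemisphere2_E_def hemisphere_def)
    fix u x v y assume "(u, x) \<in> circle_hemisphere_corr" "(v, y) \<in> circle_hemisphere_corr"
    then show "\<bar>mdist sphere1_E u v - mdist hemisphere2_E x y\<bar> \<le> 2 * (17/20)"
      using compatible_imp_distortion_le[of u v x y] compatible_correspondence[of u x v y]
        circle_hemisphere_corr_subset[of u x] circle_hemisphere_corr_subset[of v y]
      by (simp add: sphere1_E_def hemisphere2_E_def circle_def hemisphere_def)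
  qed simp
  also have "ennreal (17/20) < ennreal (sqrt 3 / 2)"
  proof (rule ennreal_lessI)
    have "17/10 < sqrt 3" by (rule real_less_rsqrt) (simp add: power2_eq_square)
    then show "17/20 < sqrt 3 / 2" by simp
  qed simp
  finally show ?thesis .
qed

end
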